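(* Let $A,B,C$ be a Leonard triple on $V$ that has $q$-Racah type with Huang data $(a,b,c,d)$, and let $W,W',W''$ be the associated elements of $\mathrm{End}(V)$ defined in the context. Then the product of the three elements $W'W$, $W''W'$, $WW''$ is equal to $(abc)^{-d}q^{d(d-1)}I$, that is, $(W'W)(W''W')(WW'')=(abc)^{-d}q^{d(d-1)}I$ (these three elements mutually commute, so the order of the factors is immaterial).
   Context: Let $\mathbb F$ be a field, $d\ge 0$ an integer, $V$ a vector space over $\mathbb F$ of dimension $d+1$, $\mathrm{End}(V)$ the $\mathbb F$-algebra of $\mathbb F$-linear maps $V\to V$, and $I$ its identity. A square matrix is tridiagonal if each nonzero entry lies on the diagonal, subdiagonal or superdiagonal; a tridiagonal matrix is irreducible if every subdiagonal entry and every superdiagonal entry is nonzero. Leonard triple on $V$: a 3-tuple $A,B,C$ of elements of $\mathrm{End}(V)$ such that (i) there is a basis of $V$ with respect to which $A$ is represented by a diagonal matrix and $B,C$ by irreducible tridiagonal matrices; (ii) there is a basis with respect to which $B$ is diagonal and $C,A$ are irreducible tridiagonal; (iii) there is a basis with respect to which $C$ is diagonal and $A,B$ are irreducible tridiagonal. Each of $A,B,C$ is then diagonalizable with one-dimensional eigenspaces. An ordering of the eigenvalues of $A$ is standard if corresponding eigenvectors, in that order, form a basis as in (i); similarly for $B$ with (ii) and $C$ with (iii). Standing assumptions: fix a nonzero $q\in\mathbb F$ with $q^4\ne 1$ and nonzero $a,b,c\in\mathbb F$ such that $q^{2i}\ne 1$ for $1\le i\le d$; none of $a^2,b^2,c^2$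 is among $q^{2d-2},q^{2d-4},\ldots,q^{2-2d}$; none of $abc,a^{-1}bc,ab^{-1}c,abc^{-1}$ is among $q^{d-1},q^{d-3},\ldots,q^{1-d}$. For $0\le i\le d$ let $\theta_i=aq^{2i-d}+a^{-1}q^{d-2i}$, $\theta'_i=bq^{2i-d}+b^{-1}q^{d-2i}$, $\theta''_i=cq^{2i-d}+c^{-1}q^{d-2i}$. A Leonard triple $A,B,C$ on $V$ has $q$-Racah type with Huang data $(a,b,c,d)$ if $\{\theta_i\}_{i=0}^d$, $\{\theta'_i\}_{i=0}^d$, $\{\theta''_i\}_{i=0}^d$ are standard orderings of the eigenvalues of $A$, $B$, $C$ respectively, and $$A+\frac{qBC-q^{-1}CB}{q^2-q^{-2}}=\alpha_a I,\quad B+\frac{qCA-q^{-1}AC}{q^2-q^{-2}}=\alpha_b I,\quad C+\frac{qAB-q^{-1}BA}{q^2-q^{-2}}=\alpha_c I,$$ where $\alpha_a=\frac{(a+a^{-1})(q^{d+1}+q^{-d-1})+(b+b^{-1})(c+c^{-1})}{q+q^{-1}}$, $\alpha_b=\frac{(b+b^{-1})(q^{d+1}+q^{-d-1})+(c+c^{-1})(a+a^{-1})}{q+q^{-1}}$, $\alpha_c=\frac{(c+c^{-1})(q^{d+1}+q^{-d-1})+(a+a^{-1})(b+b^{-1})}{q+q^{-1}}$. For $0\le i\le d$ let $E_i$ (resp. $E'_i$, $E''_i$) be the primitive idempotent of $A$ (resp. $B$, $C$) for $\theta_i$ (resp. $\theta'_i$, $\theta''_i$): the projection of $V$ onto that eigenspace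 that is zero on the other eigenspaces. Define $$W=\sum_{i=0}^d(-1)^ia^{-i}q^{i(d-i)}E_i,\quad W'=\sum_{i=0}^d(-1)^ib^{-i}q^{i(d-i)}E'_i,\quad W''=\sum_{i=0}^d(-1)^ic^{-i}q^{i(d-i)}E''_i.$$ *)

theory Defs
  imports Complex_Main
begin

definition diagonal :: "nat \<Rightarrow> (nat \<Rightarrow> nat \<Rightarrow> 'f::field) \<Rightarrow> bool" where
  "diagonal d M \<longleftrightarrow> (\<forall>i\<le>d. \<forall>j\<le>d. M i j \<noteq> 0 \<longrightarrow> i = j)"

definition tridiagonal :: "nat \<Rightarrow> (nat \<Rightarrow> nat \<Rightarrow> 'f::field) \<Rightarrow> bool" where
  "tridiagonal d M \<longleftrightarrow>
     (\<forall>i\<le>d. \<forall>j\<le>d. M i j \<noteq> 0 \<longrightarrow> i = j \<or> i = Suc j \<or> j = Suc i)"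

definition irreducible_tridiagonal :: "nat \<Rightarrow> (nat \<Rightarrow> nat \<Rightarrow> 'f::field) \<Rightarrow> bool" where
  "irreducible_tridiagonal d M \<longleftrightarrow>
     tridiagonal d M \<and> (\<forall>i<d. M (Suc i) i \<noteq> 0 \<and> M i (Suc i) \<noteq> 0)"

text \<open>Nonzero parameters \<open>q, a, b, c\<close> subject to the nondegeneracy conditions of the
  \<open>q\<close>-Racah setting. For \<open>d = 0\<close> the lists of excluded powers of \<open>q\<close> are empty.\<close>

definition q_Racah_parameters :: "'f::field \<Rightarrow> 'f \<Rightarrow> 'f \<Rightarrow> 'f \<Rightarrow> nat \<Rightarrow> bool" where
  "q_Racah_parameters q a b c d \<longleftrightarrow>
     q \<noteq> 0 \<and> q ^ 4 \<noteq> 1 \<and> a \<noteq> 0 \<and> b \<noteq> 0 \<and> c \<noteq> 0 \<and>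
     (\<forall>i\<in>{1..d}. q ^ (2 * i) \<noteq> 1) \<and>
     (\<forall>x\<in>{a\<^sup>2, b\<^sup>2, c\<^sup>2}. \<forall>k\<in>{1 - int d..int d - 1}. x \<noteq> q powi (2 * k)) \<and>
     (\<forall>x\<in>{a * b * c, inverse a * b * c, a * inverse b * c, a * b * inverse c}.
        \<forall>k<d. x \<noteq> q powi (int d - 1 - 2 * int k))"

definition Huang_eigenvalue :: "'f::field \<Rightarrow> nat \<Rightarrow> 'f \<Rightarrow> nat \<Rightarrow> 'f" where
  "Huang_eigenvalue q d a i =
     a * q powi (2 * int i - int d) + inverse a * q powi (int d - 2 * int i)"

text \<open>The scalars \<open>\<alpha>\<^sub>a, \<alpha>\<^sub>b, \<alpha>\<^sub>c\<close> are obtained from one formula by cyclically permuting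
  the last three arguments: \<open>a b c\<close>, \<open>b c a\<close>, \<open>c a b\<close>.\<close>

definition Huang_alpha :: "'f::field \<Rightarrow> nat \<Rightarrow> 'f \<Rightarrow> 'f \<Rightarrow> 'f \<Rightarrow> 'f" where
  "Huang_alpha q d a b c =
     ((a + inverse a) * (q powi (int d + 1) + q powi (- int d - 1))
        + (b + inverse b) * (c + inverse c)) / (q + inverse q)"

definition is_basis ::
    "('a::field \<Rightarrow> 'b::ab_group_add \<Rightarrow> 'b) \<Rightarrow>
       nat \<Rightarrow> (nat \<Rightarrow> 'b) \<Rightarrow> bool" where
  "is_basis scale d v \<longleftrightarrow>
     inj_on v {..d} \<and> \<not> module.dependent scale (v ` {..d}) \<and> module.span scale (v ` {..d}) = UNIV"

text \<open>Column \<open>j\<close> of the matrix consists of the coordinates of the image of the \<open>j\<close>-th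
  basis vector.\<close>

definition matrix_wrt ::
    "('a::field \<Rightarrow> 'b::ab_group_add \<Rightarrow> 'b) \<Rightarrow>
       nat \<Rightarrow> (nat \<Rightarrow> 'b) \<Rightarrow> ('b \<Rightarrow> 'b) \<Rightarrow> nat \<Rightarrow> nat \<Rightarrow> 'a" where
  "matrix_wrt scale d v X i j = module.representation scale (v ` {..d}) (X (v j)) (v i)"

definition Leonard_basis ::
    "('a::field \<Rightarrow> 'b::ab_group_add \<Rightarrow> 'b) \<Rightarrow>
       nat \<Rightarrow> ('b \<Rightarrow> 'b) \<Rightarrow> ('b \<Rightarrow> 'b) \<Rightarrow> ('b \<Rightarrow> 'b) \<Rightarrow> (nat \<Rightarrow> 'b) \<Rightarrow> bool" where
  "Leonard_basis scale d X Y Z v \<longleftrightarrow>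
     is_basis scale d v \<and>
     diagonal d (matrix_wrt scale d v X) \<and>
     irreducible_tridiagonal d (matrix_wrt scale d v Y) \<and>
     irreducible_tridiagonal d (matrix_wrt scale d v Z)"

definition Leonard_triple ::
    "('a::field \<Rightarrow> 'b::ab_group_add \<Rightarrow> 'b) \<Rightarrow>
       nat \<Rightarrow> ('b \<Rightarrow> 'b) \<Rightarrow> ('b \<Rightarrow> 'b) \<Rightarrow> ('b \<Rightarrow> 'b) \<Rightarrow> bool" where
  "Leonard_triple scale d A B C \<longleftrightarrow>
     Vector_Spaces.linear scale scale A \<and>
     Vector_Spaces.linear scale scale B \<and>
     Vector_Spaces.linear scale scale C \<and>
     (\<exists>v. Leonard_basis scale d A B C v) \<and>
     (\<exists>v. Leonard_basis scale d B C A v) \<and>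
     (\<exists>v. Leonard_basis scale d C A B v)"

definition eigenspace ::
    "('a::field \<Rightarrow> 'b::ab_group_add \<Rightarrow> 'b) \<Rightarrow>
       ('b \<Rightarrow> 'b) \<Rightarrow> 'a \<Rightarrow> 'b set" where
  "eigenspace scale X t = {x. X x = scale t x}"

definition eigenvalues ::
    "('a::field \<Rightarrow> 'b::ab_group_add \<Rightarrow> 'b) \<Rightarrow>
       ('b \<Rightarrow> 'b) \<Rightarrow> 'a set" where
  "eigenvalues scale X = {t. \<exists>x\<in>eigenspace scale X t. x \<noteq> 0}"

definition standard_ordering ::
    "('a::field \<Rightarrow> 'b::ab_group_add \<Rightarrow> 'b) \<Rightarrow>
       nat \<Rightarrow> ('b \<Rightarrow> 'b) \<Rightarrow> ('b \<Rightarrow> 'b) \<Rightarrow> ('b \<Rightarrow> 'b) \<Rightarrow> (nat \<Rightarrow> 'a) \<Rightarrow> bool" where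
  "standard_ordering scale d X Y Z t \<longleftrightarrow>
     bij_betw t {..d} (eigenvalues scale X) \<and>
     (\<exists>v. (\<forall>i\<le>d. v i \<in> eigenspace scale X (t i)) \<and> Leonard_basis scale d X Y Z v)"

definition q_Racah_type ::
    "('a::field \<Rightarrow> 'b::ab_group_add \<Rightarrow> 'b) \<Rightarrow>
       'a \<Rightarrow> 'a \<Rightarrow> 'a \<Rightarrow> 'a \<Rightarrow> nat \<Rightarrow> ('b \<Rightarrow> 'b) \<Rightarrow> ('b \<Rightarrow> 'b) \<Rightarrow> ('b \<Rightarrow> 'b) \<Rightarrow> bool" where
  "q_Racah_type scale q a b c d A B C \<longleftrightarrow>
     Leonard_triple scale d A B C \<and>
     standard_ordering scale d A B C (Huang_eigenvalue q d a) \<and>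
     standard_ordering scale d B C A (Huang_eigenvalue q d b) \<and>
     standard_ordering scale d C A B (Huang_eigenvalue q d c) \<and>
     (\<forall>x. A x + scale (inverse (q\<^sup>2 - q powi (-2)))
              (scale q (B (C x)) - scale (inverse q) (C (B x)))
            = scale (Huang_alpha q d a b c) x) \<and>
     (\<forall>x. B x + scale (inverse (q\<^sup>2 - q powi (-2)))
              (scale q (C (A x)) - scale (inverse q) (A (C x)))
            = scale (Huang_alpha q d b c a) x) \<and>
     (\<forall>x. C x + scale (inverse (q\<^sup>2 - q powi (-2)))
              (scale q (A (B x)) - scale (inverse q) (B (A x)))
            = scale (Huang_alpha q d c a b) x)"

text \<open>The description below determines a unique map when \<open>V\<close> is the direct sum of the
  eigenspaces of \<open>X\<close>, as is the case for each member of a Leonard triple.\<close>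

definition primitive_idempotent ::
    "('a::field \<Rightarrow> 'b::ab_group_add \<Rightarrow> 'b) \<Rightarrow>
       ('b \<Rightarrow> 'b) \<Rightarrow> 'a \<Rightarrow> 'b \<Rightarrow> 'b" where
  "primitive_idempotent scale X t =
     (THE E. Vector_Spaces.linear scale scale E \<and>
             range E = eigenspace scale X t \<and>
             (\<forall>x\<in>eigenspace scale X t. E x = x) \<and>
             (\<forall>s. s \<noteq> t \<longrightarrow> (\<forall>x\<in>eigenspace scale X s. E x = 0)))"

text \<open>\<open>W\<close>, \<open>W'\<close>, \<open>W''\<close> are the instances at \<open>(a, A)\<close>, \<open>(b, B)\<close>, \<open>(c, C)\<close>.\<close>

definition pseudo_intertwiner ::
    "('a::field \<Rightarrow> 'b::ab_group_add \<Rightarrow> 'b) \<Rightarrow>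
       'a \<Rightarrow> nat \<Rightarrow> 'a \<Rightarrow> ('b \<Rightarrow> 'b) \<Rightarrow> 'b \<Rightarrow> 'b" where
  "pseudo_intertwiner scale q d a X x =
     (\<Sum>i\<le>d. scale ((- 1) ^ i * a powi (- int i) * q ^ (i * (d - i)))
                (primitive_idempotent scale X (Huang_eigenvalue q d a i) x))"

end

theory Submission
  imports Defs "HOL-Computational_Algebra.Polynomial"
begin

text \<open>Put \<open>\<theta>\<^sub>i = u\<^sub>i + 1/u\<^sub>i\<close> with \<open>u\<^sub>i = a q\<^sup>2\<^sup>i\<^sup>-\<^sup>d\<close>, and let \<open>w\<^sub>i\<close> be the eigenvalue of \<open>W\<close> belonging to \<open>\<theta>\<^sub>i\<close>,
  so that \<open>w\<^sub>i\<^sub>+\<^sub>1 / w\<^sub>i = - 1 / (q u\<^sub>i)\<close>. In an eigenbasis of \<open>A\<close> the Askey-Wilson relations express the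
  entries of \<open>C\<close> by those of \<open>B\<close>: off the diagonal, the \<open>(i, j)\<close> entry of \<open>C\<close> is \<open>w\<^sub>j / w\<^sub>i\<close> times that
  of \<open>B\<close> (\<open>C_entry\<close>). Let \<open>B'\<close>, \<open>C'\<close> be the elements obtained from the relations that
  define \<open>B\<close>, \<open>C\<close> by reversing the order of the two factors. They have the diagonals of \<open>B\<close>, \<open>C\<close>, and
  off the diagonal they again differ from \<open>B\<close> by powers of \<open>w\<^sub>j / w\<^sub>i\<close>. Comparing entries gives
  \<open>W\<^sup>2 C = C' W\<^sup>2\<close>, \<open>W\<^sup>2 B' = B W\<^sup>2\<close>, \<open>W (A + B + C) = (A + B + C') W\<close> and
  \<open>W (A + B' + C) = (A + B + C) W\<close>. All hypotheses are invariant under the cyclic shift of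
  \<open>(a, A), (b, B), (c, C)\<close>, so the shifted identities hold for \<open>W'\<close> and \<open>W''\<close>.

  Commutation. The last two identities show that \<open>S = A + B + C\<close> commutes with \<open>W'W\<close>, hence also with
  \<open>W''W'\<close> and \<open>WW''\<close>. In the eigenbasis of \<open>A\<close>, \<open>S\<close> is tridiagonal, and the condition on
  \<open>a\<^sup>2\<close> makes its subdiagonal nonzero. So \<open>S\<close> has a cyclic vector and its commutant is commutative
  (\<open>commutant_commutative\<close>).

  The product is a scalar. The first two identities show that \<open>W'\<^sup>2W\<^sup>2\<close> commutes with \<open>C\<close> and
  \<open>W''\<^sup>2W'\<^sup>2\<close> with \<open>A\<close>. Hence \<open>W''\<^sup>2W'\<^sup>2W\<^sup>2\<close> commutes with \<open>A\<close> and \<open>C\<close>, and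
  therefore is a scalar \<open>\<kappa>\<close> (\<open>commuting_with_pair_scalar\<close>). As the three pair products commute, their
  product in any order equals \<open>W W''\<^sup>2W'\<^sup>2 W\<close>. This is \<open>\<kappa>\<close> as well, because \<open>W''\<^sup>2W'\<^sup>2\<close>
  commutes with \<open>A\<close> and hence with \<open>W\<close>.

  The value of the scalar. In \<open>W'\<^sup>2 W\<^sup>2 = \<kappa> W''\<^sup>-\<^sup>2\<close> write \<open>W'\<^sup>2\<close> and \<open>W''\<^sup>-\<^sup>2\<close> as polynomials of
  degree at most \<open>d\<close> in \<open>B\<close> and in \<open>C\<close>, and compare the corner entry \<open>(0, d)\<close> in the eigenbasis of \<open>A\<close>.
  Since \<open>B\<close> and \<open>C\<close> are tridiagonal there, only the coefficient of degree \<open>d\<close> contributes. It is a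
  divided difference that \<open>interpolation_on_q_quadratic_grid\<close> puts in closed form.\<close>

section \<open>Coordinates with respect to an indexed basis\<close>

locale indexed_basis = vector_space scale
  for scale :: "'f::field \<Rightarrow> 'v::ab_group_add \<Rightarrow> 'v" (infixr \<open>*s\<close> 75) +
  fixes d :: nat and v :: "nat \<Rightarrow> 'v"
  assumes basis: "is_basis scale d v"
begin

abbreviation endo :: "('v \<Rightarrow> 'v) \<Rightarrow> bool" where
  "endo \<equiv> Vector_Spaces.linear scale scale"

definition coord :: "'v \<Rightarrow> nat \<Rightarrow> 'f" where
  "coord x i = representation (v ` {..d}) x (v i)"

lemma matrix_wrt_coord: "matrix_wrt scale d v X i j = coord (X (v j)) i"
  by (simp add: matrix_wrt_def coord_def)

lemma endo_iff: "endo P \<longleftrightarrow> (\<forall>x y. P (x + y) = P x + P y) \<and> (\<forall>c x. P (c *s x) = c *s P x)"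
  using vector_space_axioms by (auto simp: Vector_Spaces.linear_iff)

lemma endo_add: "endo P \<Longrightarrow> P (x + y) = P x + P y"
  and endo_scale: "endo P \<Longrightarrow> P (c *s x) = c *s P x"
  by (simp_all add: endo_iff)

lemma endo_zero: "endo P \<Longrightarrow> P 0 = 0"
  using endo_scale[of P 0 0] by simp

lemma endo_sum: "endo P \<Longrightarrow> P (\<Sum>i\<in>I. f i) = (\<Sum>i\<in>I. P (f i))"
  by (induction I rule: infinite_finite_induct) (simp_all add: endo_zero endo_add)

lemma endo_comp: "endo P \<Longrightarrow> endo Q \<Longrightarrow> endo (P \<circ> Q)"
  by (simp add: endo_iff)

lemma endo_plus: "endo P \<Longrightarrow> endo Q \<Longrightarrow> endo (\<lambda>x. P x + Q x)"
  by (simp add: endo_iff algebra_simps scale_right_distrib)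

lemma endo_minus: "endo P \<Longrightarrow> endo Q \<Longrightarrow> endo (\<lambda>x. P x - Q x)"
  by (simp add: endo_iff algebra_simps scale_right_diff_distrib)

lemma endo_smult: "endo P \<Longrightarrow> endo (\<lambda>x. c *s P x)"
  by (simp add: endo_iff scale_right_distrib mult.commute)

lemma endo_scalar: "endo (scale c)"
  by (simp add: endo_iff scale_right_distrib mult.commute)

lemma endo_setsum: "(\<And>i. i \<in> I \<Longrightarrow> endo (f i)) \<Longrightarrow> endo (\<lambda>x. \<Sum>i\<in>I. f i x)"
  by (simp add: endo_iff sum.distrib scale_sum_right)

lemma endo_funpow: "endo P \<Longrightarrow> endo (P ^^ n)"
  by (induction n) (simp_all add: endo_comp, simp add: endo_iff)

lemma inj_v: "inj_on v {..d}"
  and independent_v: "independent (v ` {..d})"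
  and span_v: "span (v ` {..d}) = UNIV"
  using basis by (auto simp: is_basis_def)

lemma coord_add: "coord (x + y) i = coord x i + coord y i"
  and coord_diff: "coord (x - y) i = coord x i - coord y i"
  and coord_scale: "coord (c *s x) i = c * coord x i"
  using independent_v
  by (simp_all add: coord_def span_v representation_add representation_diff representation_scale)

lemma coord_zero: "coord 0 i = 0"
  by (simp add: coord_def representation_zero)

lemma coord_sum: "coord (\<Sum>k\<in>I. f k) i = (\<Sum>k\<in>I. coord (f k) i)"
  by (induction I rule: infinite_finite_induct) (simp_all add: coord_zero coord_add)

lemma coord_basis: "i \<le> d \<Longrightarrow> j \<le> d \<Longrightarrow> coord (v j) i = (if i = j then 1 else 0)"
  using inj_v by (auto simp: coord_def representation_basis[OF independent_v] inj_on_def)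

lemma expansion: "x = (\<Sum>i\<le>d. coord x i *s v i)"
proof -
  have "x = (\<Sum>b\<in>v ` {..d}. representation (v ` {..d}) x b *s b)"
    using sum_representation_eq[OF independent_v] span_v by simp
  also have "\<dots> = (\<Sum>i\<le>d. coord x i *s v i)"
    by (simp add: sum.reindex[OF inj_v] coord_def)
  finally show ?thesis .
qed

lemma coord_eqI: "(\<And>i. i \<le> d \<Longrightarrow> coord x i = coord y i) \<Longrightarrow> x = y"
  by (subst expansion[of x], subst expansion[of y]) simp

lemma endo_eqI:
  assumes "endo P" "endo Q" and "\<And>j. j \<le> d \<Longrightarrow> P (v j) = Q (v j)"
  shows "P = Q"
proof
  fix x
  show "P x = Q x"
    by (subst (1 2) expansion[of x]) (simp add: endo_sum endo_scale assms)
qed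

lemma coord_image:
  assumes "endo P"
  shows "coord (P x) i = (\<Sum>j\<le>d. coord (P (v j)) i * coord x j)"
  by (subst expansion[of x]) (simp add: endo_sum endo_scale assms coord_sum coord_scale mult.commute)

lemma subspace_eq_UNIV:
  assumes "subspace U" and "\<And>j. j \<le> d \<Longrightarrow> v j \<in> U"
  shows "U = UNIV"
  using span_minimal[of "v ` {..d}" U] assms span_v by auto

text \<open>An operator whose matrix has zeros below the subdiagonal and no zeros on it moves
  \<open>v 0\<close> through the whole space, so \<open>v 0\<close> is a cyclic vector.\<close>

lemma cyclic_vector:
  assumes S: "endo S"
    and tri: "tridiagonal d (matrix_wrt scale d v S)"
    and sub: "\<And>i. i < d \<Longrightarrow> matrix_wrt scale d v S (Suc i) i \<noteq> 0"
    and U: "subspace U" and start: "v 0 \<in> U" and closed: "\<And>x. x \<in> U \<Longrightarrow> S x \<in> U"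
  shows "U = UNIV"
proof (rule subspace_eq_UNIV[OF U])
  fix j show "j \<le> d \<Longrightarrow> v j \<in> U"
  proof (induction j rule: less_induct)
    case (less j)
    show ?case
    proof (cases j)
      case 0 then show ?thesis using start by simp
    next
      case (Suc k)
      let ?s = "\<lambda>i. coord (S (v k)) i"
      have "S (v k) = (\<Sum>i\<in>{..d}. ?s i *s v i)" by (rule expansion)
      also have "\<dots> = (\<Sum>i\<in>{..j}. ?s i *s v i)"
      proof (rule sum.mono_neutral_right)
        have "?s i = 0" if "i \<in> {..d} - {..j}" for i
          using tri that Suc less.prems unfolding tridiagonal_def matrix_wrt_coord
          by (metis Diff_iff Suc_leD atMost_iff le_SucI le_refl)
        then show "\<forall>i\<in>{..d} - {..j}. ?s i *s v i = 0" by simp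
      qed (use less.prems in auto)
      also have "{..j} = insert j {..<j}" by auto
      finally have "S (v k) = ?s j *s v j + (\<Sum>i\<in>{..<j}. ?s i *s v i)" by simp
      then have "?s j *s v j = S (v k) - (\<Sum>i\<in>{..<j}. ?s i *s v i)" by (simp add: algebra_simps)
      moreover have "S (v k) - (\<Sum>i\<in>{..<j}. ?s i *s v i) \<in> U"
        using less Suc closed U
        by (intro subspace_diff subspace_sum subspace_scale) auto
      ultimately have "inverse (?s j) *s (?s j *s v j) \<in> U"
        using U by (simp add: subspace_scale)
      moreover have "?s j \<noteq> 0"
        using sub[of k] Suc less.prems by (simp add: matrix_wrt_coord)
      ultimately show ?thesis by simp
    qed
  qed
qed

text \<open>With a cyclic vector, an element of the commutant of \<open>S\<close> is determined by its value there,
  and that value is also attained by a polynomial in \<open>S\<close>. So the commutant consists of polynomials in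
  \<open>S\<close>. Below, the polynomials are replaced by operators that commute with the whole commutant, which
  is all that matters about them.\<close>

lemma commutant_commutative:
  assumes S: "endo S"
    and tri: "tridiagonal d (matrix_wrt scale d v S)"
    and sub: "\<And>i. i < d \<Longrightarrow> matrix_wrt scale d v S (Suc i) i \<noteq> 0"
    and X: "endo X" "X \<circ> S = S \<circ> X" and Y: "endo Y" "Y \<circ> S = S \<circ> Y"
  shows "X \<circ> Y = Y \<circ> X"
proof -
  define central where
    "central P \<longleftrightarrow> endo P \<and> (\<forall>Z. endo Z \<longrightarrow> Z \<circ> S = S \<circ> Z \<longrightarrow> P \<circ> Z = Z \<circ> P)" for P
  define U where "U = {P (v 0) | P. central P}"
  have "U = UNIV"
  proof (rule cyclic_vector[OF S tri sub])
    show "subspace U"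
    proof (rule subspaceI)
      have "central (\<lambda>x. 0)" by (auto simp: central_def endo_zero fun_eq_iff) (simp add: endo_iff)
      then show "0 \<in> U" by (auto simp: U_def)
    next
      fix x y assume "x \<in> U" "y \<in> U"
      then obtain P R where "central P" "x = P (v 0)" "central R" "y = R (v 0)"
        by (auto simp: U_def)
      moreover from this have "central (\<lambda>z. P z + R z)"
        by (auto simp: central_def endo_plus fun_eq_iff endo_add)
      ultimately show "x + y \<in> U" by (force simp: U_def)
    next
      fix k x assume "x \<in> U"
      then obtain P where "central P" "x = P (v 0)"
        by (auto simp: U_def)
      moreover from this have "central (\<lambda>z. k *s P z)"
        by (auto simp: central_def endo_smult fun_eq_iff endo_scale)
      ultimately show "k *s x \<in> U" by (force simp: U_def)
    qed
    have "central id" by (auto simp: central_def endo_iff)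
    then show "v 0 \<in> U" by (auto simp: U_def intro!: exI[of _ id])
    fix x assume "x \<in> U"
    then obtain P where "central P" "x = P (v 0)"
      by (auto simp: U_def)
    moreover from this have "central (S \<circ> P)"
      using S by (auto simp: central_def endo_comp fun_eq_iff)
    ultimately show "S x \<in> U" by (auto simp: U_def intro!: exI[of _ "S \<circ> P"])
  qed
  then have "X (v 0) \<in> U" by simp
  then obtain P where P: "central P" "P (v 0) = X (v 0)"
    by (auto simp: U_def)
  have "{x. P x = X x} = UNIV"
  proof (rule cyclic_vector[OF S tri sub])
    show "subspace {x. P x = X x}"
      using P X by (auto simp: subspace_def central_def endo_add endo_scale endo_zero)
    fix x assume "x \<in> {x. P x = X x}"
    moreover have "P (S x) = S (P x)" using P S by (auto simp: central_def fun_eq_iff)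
    ultimately show "S x \<in> {x. P x = X x}" using X by (auto simp: fun_eq_iff)
  qed (use P in auto)
  then have "P = X" by auto
  then show ?thesis using P Y by (auto simp: central_def)
qed

end

section \<open>Multiplicity-free operators\<close>

definition polynomial_map ::
    "('a::field \<Rightarrow> 'b::ab_group_add \<Rightarrow> 'b) \<Rightarrow> 'a poly \<Rightarrow> ('b \<Rightarrow> 'b) \<Rightarrow> 'b \<Rightarrow> 'b" where
  "polynomial_map scale p X x = (\<Sum>n\<le>degree p. scale (coeff p n) ((X ^^ n) x))"

locale eigenbasis = indexed_basis scale d v
  for scale :: "'f::field \<Rightarrow> 'v::ab_group_add \<Rightarrow> 'v" (infixr \<open>*s\<close> 75) and d v +
  fixes X :: "'v \<Rightarrow> 'v" and t :: "nat \<Rightarrow> 'f"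
  assumes X_endo: "endo X"
    and X_eigen: "\<And>i. i \<le> d \<Longrightarrow> X (v i) = t i *s v i"
    and t_inj: "inj_on t {..d}"
begin

lemma coord_X: "i \<le> d \<Longrightarrow> coord (X x) i = t i * coord x i"
  by (subst coord_image[OF X_endo])
     (simp add: X_eigen coord_scale coord_basis mult.assoc if_distrib[of "\<lambda>z. _ * z"] if_distrib[of "\<lambda>z. z * _"] cong: if_cong)

lemma eigenvector_coord:
  assumes "X x = s *s x" "i \<le> d" "s \<noteq> t i"
  shows "coord x i = 0"
proof -
  have "t i * coord x i = s * coord x i"
    using coord_X[of i x] assms by (simp add: coord_scale)
  then show ?thesis using assms by auto
qed

lemma eigenvector_multiple:
  assumes "X x = t i *s x" "i \<le> d"
  shows "x = coord x i *s v i"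
proof (rule coord_eqI)
  fix j assume "j \<le> d"
  then show "coord x j = coord (coord x i *s v i) j"
    using eigenvector_coord[OF assms(1), of j] t_inj assms(2)
    by (auto simp: coord_scale coord_basis inj_on_def)
qed

lemma primitive_idempotent_eq:
  assumes i: "i \<le> d"
  shows "primitive_idempotent scale X (t i) = (\<lambda>x. coord x i *s v i)"
  unfolding primitive_idempotent_def
proof (rule the_equality)
  show "endo (\<lambda>x. coord x i *s v i) \<and>
      range (\<lambda>x. coord x i *s v i) = eigenspace scale X (t i) \<and>
      (\<forall>x\<in>eigenspace scale X (t i). coord x i *s v i = x) \<and>
      (\<forall>s. s \<noteq> t i \<longrightarrow> (\<forall>x\<in>eigenspace scale X s. coord x i *s v i = 0))"
  proof (intro conjI)
    show "endo (\<lambda>x. coord x i *s v i)"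
      by (simp add: endo_iff coord_add coord_scale scale_left_distrib)
    show fixed: "\<forall>x\<in>eigenspace scale X (t i). coord x i *s v i = x"
      using eigenvector_multiple i by (simp add: eigenspace_def)
    have "coord x i *s v i \<in> eigenspace scale X (t i)" for x
      using i by (simp add: eigenspace_def endo_scale[OF X_endo] X_eigen mult.commute)
    with fixed show "range (\<lambda>x. coord x i *s v i) = eigenspace scale X (t i)"
      by (metis (no_types, lifting) image_iff rangeI set_eqI)
    show "\<forall>s. s \<noteq> t i \<longrightarrow> (\<forall>x\<in>eigenspace scale X s. coord x i *s v i = 0)"
      using eigenvector_coord i by (auto simp: eigenspace_def)
  qed
next
  fix E
  assume E: "endo E \<and> range E = eigenspace scale X (t i) \<and>
      (\<forall>x\<in>eigenspace scale X (t i). E x = x) \<and>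
      (\<forall>s. s \<noteq> t i \<longrightarrow> (\<forall>x\<in>eigenspace scale X s. E x = 0))"
  show "E = (\<lambda>x. coord x i *s v i)"
  proof (rule endo_eqI)
    fix j assume j: "j \<le> d"
    have "v j \<in> eigenspace scale X (t j)" using j by (simp add: eigenspace_def X_eigen)
    moreover have "t j \<noteq> t i" if "j \<noteq> i" using that i j t_inj by (auto simp: inj_on_def)
    ultimately show "E (v j) = coord (v j) i *s v i"
      using E i j by (cases "j = i") (auto simp: coord_basis)
  qed (use E in \<open>auto simp: endo_iff coord_add coord_scale scale_left_distrib\<close>)
qed

lemma commuting_eigen:
  assumes M: "endo M" "M \<circ> X = X \<circ> M" and i: "i \<le> d"
  shows "M (v i) = coord (M (v i)) i *s v i"
proof (rule eigenvector_multiple[OF _ i])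
  have "X (M (v i)) = M (X (v i))" using M by (simp add: fun_eq_iff)
  then show "X (M (v i)) = t i *s M (v i)"
    using i by (simp add: X_eigen endo_scale M(1))
qed

lemma commutant_of_eigenbasis_commutative:
  assumes M: "endo M" "M \<circ> X = X \<circ> M" and N: "endo N" "N \<circ> X = X \<circ> N"
  shows "M \<circ> N = N \<circ> M"
proof (rule endo_eqI)
  fix i assume "i \<le> d"
  from commuting_eigen[OF M this] commuting_eigen[OF N this]
  show "(M \<circ> N) (v i) = (N \<circ> M) (v i)"
    by (metis M(1) N(1) comp_apply endo_scale mult.commute scale_scale)
qed (simp_all add: endo_comp M N)

text \<open>Commuting with \<open>X\<close> makes \<open>M\<close> diagonal. Comparing the off-diagonal entries of
  \<open>M Y\<close> and \<open>Y M\<close> then forces neighbouring diagonal entries of \<open>M\<close> to agree.\<close>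

lemma commuting_with_pair_scalar:
  assumes M: "endo M" "M \<circ> X = X \<circ> M" "M \<circ> Y = Y \<circ> M"
    and Y: "endo Y" "irreducible_tridiagonal d (matrix_wrt scale d v Y)"
  shows "\<exists>k. M = scale k"
proof -
  let ?m = "\<lambda>i. coord (M (v i)) i"
  have step: "?m (Suc i) = ?m i" if i: "i < d" for i
  proof -
    have row: "coord (M x) (Suc i) = ?m (Suc i) * coord x (Suc i)" for x
    proof -
      have off: "coord (M (v j)) (Suc i) = 0" if "j \<le> d" "j \<noteq> Suc i" for j
        by (subst commuting_eigen[OF M(1,2) that(1)])
           (use that i in \<open>auto simp: coord_scale coord_basis\<close>)
      have "coord (M x) (Suc i) = (\<Sum>j\<le>d. if j = Suc i then ?m (Suc i) * coord x j else 0)"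
        unfolding coord_image[OF M(1), of x] by (intro sum.cong) (use off in auto)
      then show ?thesis using i by simp
    qed
    have "?m (Suc i) * coord (Y (v i)) (Suc i) = coord (M (Y (v i))) (Suc i)"
      by (rule row[symmetric])
    also have "M (Y (v i)) = Y (M (v i))" using M(3) by (simp add: fun_eq_iff)
    also have "M (v i) = ?m i *s v i" by (rule commuting_eigen[OF M(1,2)]) (use i in simp)
    also have "coord (Y (?m i *s v i)) (Suc i) = ?m i * coord (Y (v i)) (Suc i)"
      by (simp add: endo_scale[OF Y(1)] coord_scale)
    finally show ?thesis
      using Y(2) i by (simp add: irreducible_tridiagonal_def matrix_wrt_coord)
  qed
  have const: "i \<le> d \<Longrightarrow> ?m i = ?m 0" for i
    by (induction i) (use step in auto)
  have "M = scale (?m 0)"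
  proof (rule endo_eqI)
    fix i assume "i \<le> d"
    then show "M (v i) = ?m 0 *s v i"
      using commuting_eigen[OF M(1,2)] const by metis
  qed (simp_all add: M endo_scalar)
  then show ?thesis ..
qed

lemma funpow_eigen: "i \<le> d \<Longrightarrow> (X ^^ n) (v i) = t i ^ n *s v i"
  by (induction n) (simp_all add: endo_scale[OF X_endo] X_eigen mult.commute)

lemma polynomial_map_eigen: "i \<le> d \<Longrightarrow> polynomial_map scale p X (v i) = poly p (t i) *s v i"
  by (simp add: polynomial_map_def funpow_eigen poly_altdef scale_sum_left)

end

context indexed_basis
begin

lemma polynomial_map_endo: "endo X \<Longrightarrow> endo (polynomial_map scale p X)"
  unfolding polynomial_map_def by (intro endo_setsum endo_smult endo_funpow)

text \<open>A tridiagonal operator moves the index by at most one, so the only path of length at most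
  \<open>n\<close> from \<open>v d\<close> to \<open>v (d - n)\<close> runs straight along the superdiagonal.\<close>

lemma tridiagonal_power_coord:
  assumes Y: "endo Y" "tridiagonal d (matrix_wrt scale d v Y)"
  shows "i + n \<le> d \<Longrightarrow> coord ((Y ^^ n) (v d)) i =
    (if i + n = d then \<Prod>k=i..<d. coord (Y (v (Suc k))) k else 0)"
proof (induction n arbitrary: i)
  case 0
  then show ?case by (simp add: coord_basis)
next
  case (Suc n)
  let ?y = "\<lambda>j. coord ((Y ^^ n) (v d)) j"
  have i: "Suc i \<le> d" using Suc.prems by simp
  have "coord ((Y ^^ Suc n) (v d)) i = (\<Sum>j\<le>d. coord (Y (v j)) i * ?y j)"
    using coord_image[OF Y(1), of "(Y ^^ n) (v d)" i] by simp
  also have "\<dots> = (\<Sum>j\<in>{Suc i}. coord (Y (v j)) i * ?y j)"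
  proof (rule sum.mono_neutral_right)
    show "\<forall>j\<in>{..d} - {Suc i}. coord (Y (v j)) i * ?y j = 0"
    proof
      fix j assume j: "j \<in> {..d} - {Suc i}"
      show "coord (Y (v j)) i * ?y j = 0"
      proof (cases "j \<le> i")
        case True
        then show ?thesis using Suc.IH[of j] Suc.prems by simp
      next
        case False
        then have "coord (Y (v j)) i = 0"
          using Y(2) j i unfolding tridiagonal_def matrix_wrt_coord
          by (metis DiffE Suc_leD atMost_iff insertI1 le_refl less_Suc_eq_le less_or_eq_imp_le)
        then show ?thesis by simp
      qed
    qed
  qed (use i in auto)
  also have "\<dots> = (if i + Suc n = d then \<Prod>k=i..<d. coord (Y (v (Suc k))) k else 0)"
    using Suc.IH[of "Suc i"] Suc.prems i by (simp add: prod.atLeast_Suc_lessThan)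
  finally show ?case .
qed

lemma polynomial_map_corner:
  assumes Y: "endo Y" "tridiagonal d (matrix_wrt scale d v Y)" and p: "degree p \<le> d"
  shows "coord (polynomial_map scale p Y (v d)) 0 =
    coeff p d * (\<Prod>k<d. coord (Y (v (Suc k))) k)"
proof -
  have "coord (polynomial_map scale p Y (v d)) 0 =
      (\<Sum>n\<le>degree p. coeff p n * coord ((Y ^^ n) (v d)) 0)"
    by (simp add: polynomial_map_def coord_sum coord_scale)
  also have "\<dots> = (\<Sum>n\<le>d. coeff p n * coord ((Y ^^ n) (v d)) 0)"
    by (rule sum.mono_neutral_left) (use p in \<open>auto simp: coeff_eq_0\<close>)
  also have "\<dots> = (\<Sum>n\<le>d. if n = d then coeff p n * (\<Prod>k<d. coord (Y (v (Suc k))) k) else 0)"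
    by (rule sum.cong) (auto simp: tridiagonal_power_coord[OF Y] atLeast0LessThan)
  finally show ?thesis by simp
qed

end

section \<open>Newton interpolation on a q-quadratic grid\<close>

text \<open>Interpolating \<open>g\<close> at consecutive nodes \<open>t\<^sub>k, \<dots>, t\<^sub>k\<^sub>+\<^sub>n\<close> gives a closed form for the leading
  coefficient, the divided difference. With base \<open>p = q\<close> this serves \<open>g\<^sub>i = w\<^sub>i\<^sup>-\<^sup>2\<close>. The nodes do
  not change when \<open>q\<close> and \<open>u\<close> are inverted, which turns the same statement into one about \<open>g\<^sub>i = w\<^sub>i\<^sup>2\<close>.\<close>

lemma interpolation_on_q_quadratic_grid:
  fixes p :: "'f::field" and u g t :: "nat \<Rightarrow> 'f"
  assumes p: "p \<noteq> 0" and u0: "\<And>k. k \<le> d \<Longrightarrow> u k \<noteq> 0"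
    and u: "\<And>k. k < d \<Longrightarrow> u (Suc k) = p\<^sup>2 * u k"
    and g: "\<And>k. k < d \<Longrightarrow> g (Suc k) = p\<^sup>2 * (u k)\<^sup>2 * g k"
    and t: "\<And>k. k \<le> d \<Longrightarrow> t k = u k + inverse (u k)"
    and inj: "inj_on t {..d}" and p1: "\<And>i. i \<in> {1..d} \<Longrightarrow> p ^ (2 * i) \<noteq> 1"
  shows "k + n \<le> d \<Longrightarrow> \<exists>h. degree h \<le> n
    \<and> coeff h n = g k * u k ^ n / (\<Prod>i=1..n. 1 - inverse p ^ (2 * i))
    \<and> (\<forall>i\<in>{k..k+n}. poly h (t i) = g i)"
proof (induction n arbitrary: k)
  case 0
  show ?case by (rule exI[of _ "[:g k:]"]) simp
next
  case (Suc n)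
  let ?P = "\<Prod>i=1..n. 1 - inverse p ^ (2 * i)"
  obtain h1 where h1: "degree h1 \<le> n" "coeff h1 n = g (Suc k) * u (Suc k) ^ n / ?P"
    "\<And>i. i \<in> {Suc k..Suc k + n} \<Longrightarrow> poly h1 (t i) = g i"
    using Suc.IH[of "Suc k"] Suc.prems by auto
  obtain h0 where h0: "degree h0 \<le> n" "coeff h0 n = g k * u k ^ n / ?P"
    "\<And>i. i \<in> {k..k + n} \<Longrightarrow> poly h0 (t i) = g i"
    using Suc.IH[of k] Suc.prems by auto
  let ?m = "k + Suc n"
  have nodes: "t ?m - t k \<noteq> 0" using inj_onD[OF inj, of ?m k] Suc.prems by auto
  \<comment> \<open>Neville's step: both interpolants are glued along the two extreme nodes.\<close>
  define h where "h = smult (inverse (t ?m - t k)) ([:- t k, 1:] * h1 - [:- t ?m, 1:] * h0)"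
  have linear_times: "degree ([:- s, 1:] * r) \<le> Suc n" if "degree r \<le> n" for s r
    by (rule order.trans[OF degree_mult_le]) (use that in simp)
  have deg: "degree h \<le> Suc n"
    unfolding h_def
    by (intro order.trans[OF degree_smult_le] degree_diff_le linear_times h1(1) h0(1))
  have "u (k + j) = p ^ (2 * j) * u k" if "k + j \<le> d" for j
    using that by (induction j) (simp_all add: u power2_eq_square)
  then have um: "u ?m = p ^ (2 * Suc n) * u k" using Suc.prems by blast
  have uk: "u k \<noteq> 0" using u0 Suc.prems by simp
  let ?w = "p ^ (2 * Suc n)"
  have w: "?w \<noteq> 0" "?w \<noteq> 1" using p p1[of "Suc n"] Suc.prems by auto
  have grid: "t ?m - t k = (?w - 1) * (u k - inverse (?w * u k))"
  proof -
    have "t ?m - t k = ?w * u k + inverse (?w * u k) - (u k + inverse (u k))"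
      using Suc.prems um by (simp only: t)
    then show ?thesis
      using uk w(1) by (simp only:) (simp add: field_simps del: mult_Suc_right power_Suc)
  qed
  have P: "?P \<noteq> 0"
    using p p1 Suc.prems by (auto simp: power_inverse)
  \<comment> \<open>The node difference is a product of two factors. One of them cancels against the difference of the
    leading coefficients, the other supplies the new factor of the denominator.\<close>
  have "coeff h (Suc n) = inverse (t ?m - t k) * (coeff h1 n - coeff h0 n)"
    using h1(1) h0(1) by (simp add: h_def coeff_eq_0)
  also have "coeff h1 n - coeff h0 n = (g k * u k ^ n / ?P) * (?w * (u k)\<^sup>2 - 1)"
    using Suc.prems P by (simp add: h1 h0 g u field_simps power_mult_distrib power_mult power_add power2_eq_square)
  also have "?w * (u k)\<^sup>2 - 1 = ?w * u k * (u k - inverse (?w * u k))"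
    using uk w by (simp add: field_simps power2_eq_square)
  also have "inverse (t ?m - t k) * (g k * u k ^ n / ?P * (?w * u k * (u k - inverse (?w * u k))))
      = g k * u k ^ Suc n / (?P * (1 - inverse ?w))"
  proof -
    have cancel: "inverse ((x - 1) * D) * (y / r * (x * z * D)) = y * z / (r * (1 - inverse x))"
      if "D \<noteq> 0" "x \<noteq> 0" "x \<noteq> 1" for x y z r D :: 'f
    proof -
      have "inverse ((x - 1) * D) * (y / r * (x * z * D))
          = (D * inverse D) * (y * z / (r * ((x - 1) / x)))"
        by (simp add: divide_inverse mult_ac)
      moreover have "1 - inverse x = (x - 1) / x" using that by (simp add: field_simps)
      ultimately show ?thesis using that by simp
    qed
    have D: "u k - inverse (?w * u k) \<noteq> 0" using nodes unfolding grid by auto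
    have pw: "g k * u k ^ Suc n = (g k * u k ^ n) * u k" by simp
    show ?thesis unfolding grid pw by (rule cancel[OF D w])
  qed
  also have "?P * (1 - inverse ?w) = (\<Prod>i=1..Suc n. 1 - inverse p ^ (2 * i))"
    by (simp add: power_inverse)
  finally have lead: "coeff h (Suc n) = g k * u k ^ Suc n / (\<Prod>i=1..Suc n. 1 - inverse p ^ (2 * i))" .
  have "poly h (t i) = g i" if i: "i \<in> {k..?m}" for i
  proof -
    have "poly h (t i) = inverse (t ?m - t k) * ((t i - t k) * poly h1 (t i) - (t i - t ?m) * poly h0 (t i))"
      by (simp add: h_def algebra_simps)
    also have "(t i - t k) * poly h1 (t i) = (t i - t k) * g i"
      using h1(3)[of i] i by (cases "i = k") auto
    also have "(t i - t ?m) * poly h0 (t i) = (t i - t ?m) * g i"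
      using h0(3)[of i] i by (cases "i = ?m") auto
    also have "(t i - t k) * g i - (t i - t ?m) * g i = (t ?m - t k) * g i"
      by (simp add: algebra_simps)
    finally show ?thesis using nodes by simp
  qed
  with deg lead show ?case by blast
qed

section \<open>The pseudo intertwiner in an eigenbasis\<close>

text \<open>For \<open>\<alpha> = \<alpha>\<^sub>c\<close> the relations of \<open>q\<close>-Racah type say that \<open>C\<close> is the partner of \<open>A\<close> and \<open>B\<close>. The
  partner of \<open>B\<close> and \<open>A\<close> is in general a different element.\<close>

definition partner ::
    "('a::field \<Rightarrow> 'b::ab_group_add \<Rightarrow> 'b) \<Rightarrow> 'a \<Rightarrow> 'a \<Rightarrow> ('b \<Rightarrow> 'b) \<Rightarrow> ('b \<Rightarrow> 'b) \<Rightarrow> 'b \<Rightarrow> 'b" where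
  "partner scale q \<alpha> X Y x = scale \<alpha> x -
     scale (inverse (q\<^sup>2 - q powi (-2))) (scale q (X (Y x)) - scale (inverse q) (Y (X x)))"

lemma (in indexed_basis) endo_partner:
  assumes "endo X" "endo Y"
  shows "endo (partner scale q \<alpha> X Y)"
proof -
  have "endo (\<lambda>x. X (Y x))" "endo (\<lambda>x. Y (X x))"
    using assms by (simp_all add: endo_iff)
  then show ?thesis
    unfolding partner_def by (intro endo_minus endo_smult endo_scalar)
qed

lemma (in indexed_basis) diagonal_intertwines:
  assumes D: "endo D" "\<And>j. j \<le> d \<Longrightarrow> D (v j) = f j *s v j"
    and P: "endo P" and R: "endo R"
    and eq: "\<And>i j. i \<le> d \<Longrightarrow> j \<le> d \<Longrightarrow> f i * coord (P (v j)) i = f j * coord (R (v j)) i"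
  shows "D \<circ> P = R \<circ> D"
proof (rule endo_eqI)
  fix j assume j: "j \<le> d"
  show "(D \<circ> P) (v j) = (R \<circ> D) (v j)"
  proof (rule coord_eqI)
    fix i assume i: "i \<le> d"
    have "coord (D (P (v j))) i = (\<Sum>k\<le>d. if k = i then f i * coord (P (v j)) k else 0)"
      by (subst coord_image[OF D(1)], rule sum.cong) (use i in \<open>auto simp: D(2) coord_scale coord_basis\<close>)
    then show "coord ((D \<circ> P) (v j)) i = coord ((R \<circ> D) (v j)) i"
      using i j by (simp add: eq D(2) endo_scale[OF R] coord_scale)
  qed
qed (simp_all add: endo_comp D P R)

locale racah_eigenbasis = indexed_basis scale d v
  for scale :: "'f::field \<Rightarrow> 'v::ab_group_add \<Rightarrow> 'v" (infixr \<open>*s\<close> 75) and d v +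
  fixes q a b c :: 'f and A B C :: "'v \<Rightarrow> 'v"
  assumes params: "q_Racah_parameters q a b c d"
    and racah: "q_Racah_type scale q a b c d A B C"
    and v_eigen: "\<And>i. i \<le> d \<Longrightarrow> v i \<in> eigenspace scale A (Huang_eigenvalue q d a i)"
    and v_Leonard: "Leonard_basis scale d A B C v"
begin

abbreviation \<theta> :: "nat \<Rightarrow> 'f" where "\<theta> \<equiv> Huang_eigenvalue q d a"
abbreviation W :: "'v \<Rightarrow> 'v" where "W \<equiv> pseudo_intertwiner scale q d a A"

definition u :: "nat \<Rightarrow> 'f" where "u i = a * q powi (2 * int i - int d)"
definition w :: "nat \<Rightarrow> 'f" where "w i = (- 1) ^ i * a powi (- int i) * q ^ (i * (d - i))"

lemma q_nonzero: "q \<noteq> 0" and a_nonzero: "a \<noteq> 0" and q4: "q ^ 4 \<noteq> 1"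
  and q_powers: "i \<in> {1..d} \<Longrightarrow> q ^ (2 * i) \<noteq> 1"
  using params by (simp_all add: q_Racah_parameters_def)

lemma endo_A: "endo A" and endo_B: "endo B" and endo_C: "endo C"
  using racah by (simp_all add: q_Racah_type_def Leonard_triple_def)

lemma \<theta>_inj: "inj_on \<theta> {..d}"
  using racah by (auto simp: q_Racah_type_def standard_ordering_def bij_betw_def)

sublocale eigenbasis scale d v A \<theta>
  by (intro eigenbasis.intro indexed_basis_axioms eigenbasis_axioms.intro)
     (use endo_A \<theta>_inj v_eigen in \<open>simp_all add: eigenspace_def\<close>)

lemma u_nonzero: "u i \<noteq> 0"
  using a_nonzero q_nonzero by (simp add: u_def)

lemma u_Suc: "u (Suc i) = q\<^sup>2 * u i"
proof -
  have "q powi (2 * int (Suc i) - int d) = q powi (2 * int i - int d) * q powi 2"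
    using q_nonzero by (subst power_int_add[symmetric]) (auto simp: algebra_simps)
  then show ?thesis by (simp add: u_def)
qed

lemma \<theta>_eq: "\<theta> i = u i + inverse (u i)"
  by (simp add: Huang_eigenvalue_def u_def power_int_minus[symmetric])

lemma w_nonzero: "w i \<noteq> 0"
  using a_nonzero q_nonzero by (simp add: w_def)

lemma w_0: "w 0 = 1"
  by (simp add: w_def)

lemma w_Suc:
  assumes "i < d"
  shows "w (Suc i) = - inverse (q * u i) * w i"
proof -
  obtain e where d: "d = Suc (i + e)" using less_imp_Suc_add[OF assms] by blast
  have "q powi (2 * int i - int d) = q powi (int i) * inverse (q powi (int (Suc e)))"
    using q_nonzero by (subst power_int_minus[symmetric], subst power_int_add[symmetric]) (auto simp: d algebra_simps)
  then have "u i = a * q ^ i / q ^ Suc e" by (simp only: u_def power_int_of_nat divide_inverse mult.assoc)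
  then have "q * u i = a * q ^ i / q ^ e"
    using q_nonzero by (simp add: field_simps)
  then have ratio: "inverse (q * u i) = inverse a * q ^ e / q ^ i"
    using a_nonzero q_nonzero by (simp only:) (simp add: field_simps)
  have a_power: "a powi (- int (Suc i)) = inverse a * a powi (- int i)"
    unfolding power_int_minus power_int_of_nat by simp
  have "d - i = Suc e" "d - Suc i = e" using d by simp_all
  then show ?thesis
    unfolding w_def ratio a_power using q_nonzero by (simp add: power_add field_simps)
qed

lemma W_endo: "endo W"
  unfolding pseudo_intertwiner_def
  by (intro endo_setsum endo_smult) (simp add: primitive_idempotent_eq endo_iff coord_add coord_scale scale_left_distrib)

lemma W_eigen: "j \<le> d \<Longrightarrow> W (v j) = w j *s v j"
proof -
  assume j: "j \<le> d"
  have "W (v j) = (\<Sum>i\<le>d. if i = j then w j *s v j else 0)"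
    unfolding pseudo_intertwiner_def
    by (rule sum.cong) (use j in \<open>auto simp: primitive_idempotent_eq coord_basis w_def\<close>)
  then show ?thesis using j by simp
qed

abbreviation Q :: 'f where "Q \<equiv> q\<^sup>2 - q powi (-2)"
text \<open>\<open>B'\<close> and \<open>C'\<close> come from the relations for \<open>B\<close> and \<open>C\<close> by exchanging the two factors, compare
  \<open>B_eq\<close> and \<open>C_eq\<close>. After one cyclic shift the element \<open>C'\<close> takes the place of \<open>B'\<close>.\<close>

abbreviation B' :: "'v \<Rightarrow> 'v" where "B' \<equiv> partner scale q (Huang_alpha q d b c a) A C"
abbreviation C' :: "'v \<Rightarrow> 'v" where "C' \<equiv> partner scale q (Huang_alpha q d c a b) B A"

lemma Q_nonzero: "Q \<noteq> 0"
proof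
  assume "Q = 0"
  then have "q\<^sup>2 = inverse (q\<^sup>2)" by (simp add: power_int_minus)
  then have "q\<^sup>2 * q\<^sup>2 = 1" using q_nonzero by (metis power_not_zero right_inverse)
  then show False using q4 by (simp add: power2_eq_square power4_eq_xxxx mult.assoc)
qed

text \<open>This is why \<open>W\<close> has the eigenvalues it has: for neighbouring indices the factor with which the
  relations take an off-diagonal entry of \<open>B\<close> to one of \<open>C\<close> is a ratio of two of them.\<close>

lemma twist:
  assumes "i \<le> d" "j \<le> d" "i = Suc j \<or> j = Suc i"
  shows "q * \<theta> i - inverse q * \<theta> j = - (w j / w i) * Q"
proof -
  have Q: "Q = q\<^sup>2 - inverse (q\<^sup>2)" by (simp add: power_int_minus)
  have up: "q * \<theta> k - inverse q * \<theta> (Suc k) = - (w (Suc k) / w k) * Q"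
    and down: "q * \<theta> (Suc k) - inverse q * \<theta> k = - (w k / w (Suc k)) * Q" if "k < d" for k
  proof -
    have r: "w (Suc k) / w k = - inverse (q * u k)"
      using w_Suc[OF that] w_nonzero[of k] by simp
    then have r': "w k / w (Suc k) = - (q * u k)"
      by (metis inverse_divide inverse_inverse_eq inverse_minus_eq)
    show "q * \<theta> k - inverse q * \<theta> (Suc k) = - (w (Suc k) / w k) * Q"
      unfolding r Q \<theta>_eq u_Suc using q_nonzero u_nonzero[of k] by (simp add: field_simps power2_eq_square)
    show "q * \<theta> (Suc k) - inverse q * \<theta> k = - (w k / w (Suc k)) * Q"
      unfolding r' Q \<theta>_eq u_Suc using q_nonzero u_nonzero[of k] by (simp add: field_simps power2_eq_square)
  qed
  show ?thesis using assms up[of i] down[of j] by auto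
qed

lemma B_eq: "B = partner scale q (Huang_alpha q d b c a) C A"
  and C_eq: "C = partner scale q (Huang_alpha q d c a b) A B"
proof -
  have "B x + inverse Q *s (q *s C (A x) - inverse q *s A (C x)) = Huang_alpha q d b c a *s x"
    "C x + inverse Q *s (q *s A (B x) - inverse q *s B (A x)) = Huang_alpha q d c a b *s x" for x
    using racah unfolding q_Racah_type_def by blast+
  then show "B = partner scale q (Huang_alpha q d b c a) C A" "C = partner scale q (Huang_alpha q d c a b) A B"
    unfolding partner_def fun_eq_iff by (simp_all add: eq_diff_eq)
qed

lemma coord_A: "i \<le> d \<Longrightarrow> j \<le> d \<Longrightarrow> coord (A (v j)) i = (if i = j then \<theta> i else 0)"
  by (simp add: coord_X coord_basis)

lemma coord_partner:
  assumes Y: "endo Y" and ij: "i \<le> d" "j \<le> d"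
  shows "coord (partner scale q \<alpha> A Y (v j)) i = (if i = j then \<alpha> else 0)
      - inverse Q * (q * \<theta> i - inverse q * \<theta> j) * coord (Y (v j)) i"
    and "coord (partner scale q \<alpha> Y A (v j)) i = (if i = j then \<alpha> else 0)
      - inverse Q * (q * \<theta> j - inverse q * \<theta> i) * coord (Y (v j)) i"
  using ij
  by (simp_all add: partner_def coord_diff coord_scale coord_basis coord_X X_eigen endo_scale[OF Y]
      ring_distribs mult.assoc)

lemma irreducible_B: "irreducible_tridiagonal d (matrix_wrt scale d v B)"
  and irreducible_C: "irreducible_tridiagonal d (matrix_wrt scale d v C)"
  using v_Leonard by (simp_all add: Leonard_basis_def)

lemma tridiagonal_B: "tridiagonal d (matrix_wrt scale d v B)"
  and tridiagonal_C: "tridiagonal d (matrix_wrt scale d v C)"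
  using irreducible_B irreducible_C by (simp_all add: irreducible_tridiagonal_def)

lemma adjacent_entries:
  assumes "i \<le> d" "j \<le> d" "i = Suc j \<or> j = Suc i"
  shows C_entry: "coord (C (v j)) i = w j / w i * coord (B (v j)) i"
    and C'_entry: "coord (C' (v j)) i = w i / w j * coord (B (v j)) i"
    and B'_entry: "coord (B' (v j)) i = (w j / w i)\<^sup>2 * coord (B (v j)) i"
proof -
  have t: "inverse Q * (q * \<theta> i - inverse q * \<theta> j) = - (w j / w i)"
    unfolding twist[OF assms] using Q_nonzero by simp
  have t': "inverse Q * (q * \<theta> j - inverse q * \<theta> i) = - (w i / w j)"
    unfolding twist[OF assms(2,1) disj_commute[THEN iffD1, OF assms(3)]] using Q_nonzero by simp
  have ne: "i \<noteq> j" using assms by auto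
  show C: "coord (C (v j)) i = w j / w i * coord (B (v j)) i"
    by (subst C_eq, subst coord_partner(1)[OF endo_B assms(1,2)]) (simp add: t ne)
  show "coord (C' (v j)) i = w i / w j * coord (B (v j)) i"
    by (subst coord_partner(2)[OF endo_B assms(1,2)]) (simp add: t' ne)
  show "coord (B' (v j)) i = (w j / w i)\<^sup>2 * coord (B (v j)) i"
    by (subst coord_partner(1)[OF endo_C assms(1,2)]) (simp add: t ne C, simp add: power2_eq_square)
qed

lemma diagonal_entries:
  assumes "i \<le> d"
  shows "coord (C' (v i)) i = coord (C (v i)) i" and "coord (B' (v i)) i = coord (B (v i)) i"
proof -
  show "coord (C' (v i)) i = coord (C (v i)) i"
    by (subst C_eq) (simp add: coord_partner endo_B assms)
  show "coord (B' (v i)) i = coord (B (v i)) i"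
    by (subst B_eq) (simp add: coord_partner endo_C assms)
qed

lemma distant_entries:
  assumes "i \<le> d" "j \<le> d" "i \<noteq> j" "i \<noteq> Suc j" "j \<noteq> Suc i"
  shows "coord (B (v j)) i = 0" "coord (C (v j)) i = 0" "coord (B' (v j)) i = 0" "coord (C' (v j)) i = 0"
proof -
  show B: "coord (B (v j)) i = 0" and C: "coord (C (v j)) i = 0"
    using tridiagonal_B tridiagonal_C assms unfolding tridiagonal_def matrix_wrt_coord by blast+
  then show "coord (B' (v j)) i = 0" "coord (C' (v j)) i = 0"
    using assms by (simp_all add: coord_partner endo_B endo_C)
qed

lemma entry_cases:
  assumes "i \<le> d" "j \<le> d"
  obtains (diagonal) "i = j" "coord (C' (v j)) i = coord (C (v j)) i" "coord (B' (v j)) i = coord (B (v j)) i"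
  | (adjacent) "i \<noteq> j" "coord (C (v j)) i = w j / w i * coord (B (v j)) i"
      "coord (C' (v j)) i = w i / w j * coord (B (v j)) i"
      "coord (B' (v j)) i = (w j / w i)\<^sup>2 * coord (B (v j)) i"
  | (distant) "i \<noteq> j" "coord (B (v j)) i = 0" "coord (C (v j)) i = 0" "coord (B' (v j)) i = 0" "coord (C' (v j)) i = 0"
proof -
  consider "i = j" | "i = Suc j \<or> j = Suc i" | "i \<noteq> j" "i \<noteq> Suc j" "j \<noteq> Suc i" by blast
  then show ?thesis
  proof cases
    case 1
    then show ?thesis using diagonal diagonal_entries[OF assms(1)] by simp
  next
    case 2
    then show ?thesis using adjacent adjacent_entries[OF assms 2] by auto
  next
    case 3
    then show ?thesis using distant distant_entries[OF assms] by blast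
  qed
qed

lemma endo_B': "endo B'" and endo_C': "endo C'"
  by (simp_all add: endo_partner endo_A endo_B endo_C)

text \<open>The following four identities hold entry by entry. On the diagonal both sides agree, and off it
  \<open>C\<close>, \<open>C'\<close>, \<open>B'\<close> are \<open>r B\<close>, \<open>r\<^sup>-\<^sup>1 B\<close>, \<open>r\<^sup>2 B\<close> with \<open>r = w\<^sub>j / w\<^sub>i\<close>, while conjugation by \<open>W\<close>
  multiplies the entry by \<open>r\<^sup>-\<^sup>1\<close> or \<open>r\<close>. For the sums, the point is that
  \<open>1 + r = r (1 + r\<^sup>-\<^sup>1)\<close>.\<close>

lemma W_square_C: "(W \<circ> W) \<circ> C = C' \<circ> (W \<circ> W)"
proof (rule diagonal_intertwines[where f = "\<lambda>i. (w i)\<^sup>2"])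
  fix i j assume "i \<le> d" "j \<le> d"
  then show "(w i)\<^sup>2 * coord (C (v j)) i = (w j)\<^sup>2 * coord (C' (v j)) i"
    by (cases rule: entry_cases) (use w_nonzero in \<open>simp_all add: field_simps power2_eq_square\<close>)
qed (simp_all add: endo_comp endo_C endo_C' W_endo W_eigen endo_scale[OF W_endo] power2_eq_square)

lemma W_square_B: "(W \<circ> W) \<circ> B' = B \<circ> (W \<circ> W)"
proof (rule diagonal_intertwines[where f = "\<lambda>i. (w i)\<^sup>2"])
  fix i j assume "i \<le> d" "j \<le> d"
  then show "(w i)\<^sup>2 * coord (B' (v j)) i = (w j)\<^sup>2 * coord (B (v j)) i"
    by (cases rule: entry_cases) (use w_nonzero in \<open>simp_all add: field_simps power2_eq_square\<close>)
qed (simp_all add: endo_comp endo_B endo_B' W_endo W_eigen endo_scale[OF W_endo] power2_eq_square)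

lemma W_sum: "W \<circ> (\<lambda>x. A x + B x + C x) = (\<lambda>x. A x + B x + C' x) \<circ> W"
proof (rule diagonal_intertwines[where f = w])
  fix i j assume ij: "i \<le> d" "j \<le> d"
  then show "w i * coord (A (v j) + B (v j) + C (v j)) i = w j * coord (A (v j) + B (v j) + C' (v j)) i"
  proof (cases rule: entry_cases)
    case adjacent
    show ?thesis
      unfolding coord_add adjacent(2-4)
      using w_nonzero ij adjacent(1) by (simp add: coord_A field_simps power2_eq_square)
  qed (simp_all add: coord_add coord_A ij)
qed (simp_all add: endo_plus endo_A endo_B endo_C endo_C' W_endo W_eigen)

lemma sum_W: "W \<circ> (\<lambda>x. A x + B' x + C x) = (\<lambda>x. A x + B x + C x) \<circ> W"
proof (rule diagonal_intertwines[where f = w])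
  fix i j assume ij: "i \<le> d" "j \<le> d"
  then show "w i * coord (A (v j) + B' (v j) + C (v j)) i = w j * coord (A (v j) + B (v j) + C (v j)) i"
  proof (cases rule: entry_cases)
    case adjacent
    show ?thesis
      unfolding coord_add adjacent(2-4)
      using w_nonzero ij adjacent(1) by (simp add: coord_A field_simps power2_eq_square)
  qed (simp_all add: coord_add coord_A ij)
qed (simp_all add: endo_plus endo_A endo_B endo_C endo_B' W_endo W_eigen)

lemma W_A: "W \<circ> A = A \<circ> W"
proof (rule diagonal_intertwines[where f = w])
qed (simp_all add: endo_A W_endo W_eigen coord_A)

text \<open>The subdiagonal entry of \<open>A + B + C\<close> is that of \<open>B\<close> times \<open>1 - q u\<^sub>i\<close>, and \<open>q u\<^sub>i = 1\<close> would make
  \<open>a\<^sup>2\<close> one of the excluded powers of \<open>q\<close>.\<close>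

lemma sum_commutant_commutative:
  assumes X: "endo X" "\<And>x. X (A x + B x + C x) = A (X x) + B (X x) + C (X x)"
    and Y: "endo Y" "\<And>x. Y (A x + B x + C x) = A (Y x) + B (Y x) + C (Y x)"
  shows "X \<circ> Y = Y \<circ> X"
proof (rule commutant_commutative[where S = "\<lambda>x. A x + B x + C x"])
  show "tridiagonal d (matrix_wrt scale d v (\<lambda>x. A x + B x + C x))"
    unfolding tridiagonal_def matrix_wrt_coord
  proof (intro allI impI)
    fix i j assume ij: "i \<le> d" "j \<le> d" and entry: "coord (A (v j) + B (v j) + C (v j)) i \<noteq> 0"
    show "i = j \<or> i = Suc j \<or> j = Suc i"
    proof (rule ccontr)
      assume far: "\<not> (i = j \<or> i = Suc j \<or> j = Suc i)"
      then have "coord (B (v j)) i = 0" "coord (C (v j)) i = 0"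
        using distant_entries(1,2)[OF ij] by blast+
      moreover have "coord (A (v j)) i = 0" using far by (simp add: coord_A[OF ij])
      ultimately show False using entry by (simp add: coord_add)
    qed
  qed
  fix i assume i: "i < d"
  have "q * u i \<noteq> 1"
  proof
    assume "q * u i = 1"
    then have "a * q powi (2 * int i + 1 - int d) = 1"
      using q_nonzero by (simp add: u_def power_int_add power_int_diff field_simps)
    then have "a = q powi (int d - 1 - 2 * int i)"
      using q_nonzero a_nonzero by (simp add: power_int_add power_int_diff field_simps)
    then have "a\<^sup>2 = q powi (2 * (int d - 1 - 2 * int i))"
      by (metis mult.commute power_int_mult power_int_numeral)
    moreover have "int d - 1 - 2 * int i \<in> {1 - int d..int d - 1}" using i by simp
    ultimately show False using params unfolding q_Racah_parameters_def by blast
  qed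
  moreover have "w i / w (Suc i) = - (q * u i)"
    using w_Suc[OF i] w_nonzero[of i] w_nonzero[of "Suc i"] q_nonzero u_nonzero[of i]
    by (simp add: field_simps)
  ultimately have "1 + w i / w (Suc i) \<noteq> 0" by simp
  moreover have "coord (B (v i)) (Suc i) \<noteq> 0"
    using irreducible_B i by (simp add: irreducible_tridiagonal_def matrix_wrt_coord)
  ultimately have "(1 + w i / w (Suc i)) * coord (B (v i)) (Suc i) \<noteq> 0" by simp
  then show "matrix_wrt scale d v (\<lambda>x. A x + B x + C x) (Suc i) i \<noteq> 0"
    using i by (simp add: matrix_wrt_coord coord_add coord_A C_entry distrib_right)
qed (use X Y in \<open>auto simp: endo_plus endo_A endo_B endo_C fun_eq_iff\<close>)

lemma W_square_polynomial:
  "\<exists>h. degree h \<le> d \<and> coeff h d = inverse (u 0) ^ d / (\<Prod>i=1..d. 1 - q ^ (2 * i))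
     \<and> polynomial_map scale h A = W \<circ> W"
proof -
  have "\<exists>h. degree h \<le> d
    \<and> coeff h d = (w 0)\<^sup>2 * inverse (u 0) ^ d / (\<Prod>i=1..d. 1 - inverse (inverse q) ^ (2 * i))
    \<and> (\<forall>i\<in>{0..0+d}. poly h (\<theta> i) = (w i)\<^sup>2)"
  proof (rule interpolation_on_q_quadratic_grid[where d = d])
    show "w (Suc k) ^ 2 = (inverse q)\<^sup>2 * (inverse (u k))\<^sup>2 * (w k)\<^sup>2" if "k < d" for k
      unfolding w_Suc[OF that] by (simp add: power_mult_distrib inverse_mult_distrib)
    show "\<theta> k = inverse (u k) + inverse (inverse (u k))" for k by (simp add: \<theta>_eq)
  qed (use q_nonzero u_nonzero u_Suc \<theta>_inj q_powers in \<open>auto simp: power_inverse\<close>)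
  then obtain h where h: "degree h \<le> d" "coeff h d = inverse (u 0) ^ d / (\<Prod>i=1..d. 1 - q ^ (2 * i))"
    "\<And>i. i \<le> d \<Longrightarrow> poly h (\<theta> i) = (w i)\<^sup>2"
    by (auto simp: w_0)
  have "polynomial_map scale h A = W \<circ> W"
    by (rule endo_eqI)
       (simp_all add: polynomial_map_endo endo_A endo_comp W_endo polynomial_map_eigen h W_eigen
          endo_scale[OF W_endo] power2_eq_square)
  with h show ?thesis by blast
qed

lemma W_square_inverse_polynomial:
  "\<exists>h. degree h \<le> d \<and> coeff h d = u 0 ^ d / (\<Prod>i=1..d. 1 - inverse q ^ (2 * i))
     \<and> polynomial_map scale h A \<circ> (W \<circ> W) = id"
proof -
  have "\<exists>h. degree h \<le> d
    \<and> coeff h d = (inverse (w 0))\<^sup>2 * u 0 ^ d / (\<Prod>i=1..d. 1 - inverse q ^ (2 * i))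
    \<and> (\<forall>i\<in>{0..0+d}. poly h (\<theta> i) = (inverse (w i))\<^sup>2)"
  proof (rule interpolation_on_q_quadratic_grid[where d = d])
    show "(inverse (w (Suc k)))\<^sup>2 = q\<^sup>2 * (u k)\<^sup>2 * (inverse (w k))\<^sup>2" if "k < d" for k
      unfolding w_Suc[OF that] by (simp add: power_mult_distrib inverse_mult_distrib)
    show "\<theta> k = u k + inverse (u k)" for k by (rule \<theta>_eq)
  qed (use q_nonzero u_nonzero u_Suc \<theta>_inj q_powers in auto)
  then obtain h where h: "degree h \<le> d" "coeff h d = u 0 ^ d / (\<Prod>i=1..d. 1 - inverse q ^ (2 * i))"
    "\<And>i. i \<le> d \<Longrightarrow> poly h (\<theta> i) = (inverse (w i))\<^sup>2"
    by (auto simp: w_0)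
  have "polynomial_map scale h A \<circ> (W \<circ> W) = id"
  proof (rule endo_eqI)
    fix j assume "j \<le> d"
    moreover have "w j * w j * (inverse (w j) * inverse (w j)) = 1"
      using w_nonzero[of j] by (simp add: field_simps)
    ultimately show "(polynomial_map scale h A \<circ> (W \<circ> W)) (v j) = id (v j)"
      by (simp add: W_eigen endo_scale[OF W_endo] endo_scale[OF polynomial_map_endo[OF endo_A]]
          polynomial_map_eigen h power2_eq_square)
  qed (simp_all add: polynomial_map_endo endo_A endo_comp W_endo, simp add: endo_iff)
  with h show ?thesis by blast
qed

lemma superdiagonal_ratio:
  "(\<Prod>k<d. coord (C (v (Suc k))) k) = w d * (\<Prod>k<d. coord (B (v (Suc k))) k)"
proof -
  have "(\<Prod>k<n. coord (C (v (Suc k))) k) = w n * (\<Prod>k<n. coord (B (v (Suc k))) k)" if "n \<le> d" for n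
    using that by (induction n) (simp_all add: w_0 C_entry w_nonzero)
  then show ?thesis by simp
qed

text \<open>The coordinate at \<open>v 0\<close> of \<open>h(B) v\<^sub>d\<close> is the leading coefficient of \<open>h\<close> times the
  product of the superdiagonal of \<open>B\<close>, and likewise for \<open>C\<close>. The two products differ by the telescoping
  factor \<open>w\<^sub>d / w\<^sub>0 = w\<^sub>d\<close>, which cancels one of the two factors \<open>w\<^sub>d\<close> that \<open>W\<^sup>2\<close> contributes.\<close>

lemma corner_comparison:
  assumes h: "degree h \<le> d" and g: "degree g \<le> d"
    and eq: "\<And>x. polynomial_map scale h B (W (W x)) = k *s polynomial_map scale g C x"
  shows "w d * coeff h d = k * coeff g d"
proof -
  let ?b = "\<Prod>k<d. coord (B (v (Suc k))) k"
  have "?b \<noteq> 0"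
    using irreducible_B by (auto simp: irreducible_tridiagonal_def matrix_wrt_coord)
  have "w d * (w d * (coeff h d * ?b)) = coord (polynomial_map scale h B (W (W (v d)))) 0"
    by (simp add: W_eigen endo_scale[OF W_endo] endo_scale[OF polynomial_map_endo[OF endo_B]] coord_scale
        polynomial_map_corner[OF endo_B tridiagonal_B h])
  also have "\<dots> = k * (coeff g d * (w d * ?b))"
    by (simp add: eq coord_scale polynomial_map_corner[OF endo_C tridiagonal_C g] superdiagonal_ratio)
  finally have "(w d * coeff h d) * (w d * ?b) = (k * coeff g d) * (w d * ?b)"
    by (simp add: mult_ac)
  then show ?thesis using \<open>?b \<noteq> 0\<close> w_nonzero by simp
qed

end


section \<open>The three pair products\<close>

lemma prod_one_minus_inverse_power:
  fixes q :: "'f::field"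
  assumes "q \<noteq> 0"
  shows "(- 1) ^ n * q ^ (n * (n + 1)) * (\<Prod>i=1..n. 1 - inverse q ^ (2 * i)) = (\<Prod>i=1..n. 1 - q ^ (2 * i))"
proof (induction n)
  case (Suc n)
  have "Suc n * (Suc n + 1) = n * (n + 1) + 2 * Suc n" by simp
  then have "(- 1) ^ Suc n * q ^ (Suc n * (Suc n + 1)) * (\<Prod>i=1..Suc n. 1 - inverse q ^ (2 * i))
      = ((- 1) ^ n * q ^ (n * (n + 1)) * (\<Prod>i=1..n. 1 - inverse q ^ (2 * i)))
        * (- (q ^ (2 * Suc n)) * (1 - inverse q ^ (2 * Suc n)))"
    by (simp only: power_add) (simp add: mult_ac)
  also have "- (q ^ (2 * Suc n)) * (1 - inverse q ^ (2 * Suc n)) = 1 - q ^ (2 * Suc n)"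
    using assms by (simp add: power_inverse right_diff_distrib del: mult_Suc_right power_Suc)
  moreover have "(\<Prod>i=1..Suc n. 1 - q ^ (2 * i)) = (\<Prod>i=1..n. 1 - q ^ (2 * i)) * (1 - q ^ (2 * Suc n))"
    by simp
  ultimately show ?case by (simp only: Suc.IH)
qed simp

lemma q_Racah_parameters_rotate:
  "q_Racah_parameters q a b c d \<Longrightarrow> q_Racah_parameters q b c a d"
  unfolding q_Racah_parameters_def by (auto simp: mult_ac)

lemma q_Racah_type_rotate:
  "q_Racah_type scale q a b c d A B C \<Longrightarrow> q_Racah_type scale q b c a d B C A"
  unfolding q_Racah_type_def Leonard_triple_def by blast

lemma q_Racah_type_eigenbasis:
  assumes "vector_space scale" "q_Racah_parameters q a b c d" "q_Racah_type scale q a b c d A B C"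
  shows "\<exists>v. racah_eigenbasis scale d v q a b c A B C"
proof -
  obtain v where v: "\<And>i. i \<le> d \<Longrightarrow> v i \<in> eigenspace scale A (Huang_eigenvalue q d a i)"
    "Leonard_basis scale d A B C v"
    using assms(3) by (auto simp: q_Racah_type_def standard_ordering_def)
  have "racah_eigenbasis scale d v q a b c A B C"
    by (intro racah_eigenbasis.intro indexed_basis.intro indexed_basis_axioms.intro racah_eigenbasis_axioms.intro assms v)
       (use v(2) in \<open>simp add: Leonard_basis_def\<close>)
  then show ?thesis by blast
qed

theorem theorem13p5:
  fixes scale :: "'f::field \<Rightarrow> 'v::ab_group_add \<Rightarrow> 'v"
    and d :: nat and q a b c :: 'f
    and A B C W W' W'' :: "'v \<Rightarrow> 'v"
  assumes "vector_space scale"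
    and "vector_space.dim scale (UNIV :: 'v set) = d + 1"
    and "q_Racah_parameters q a b c d"
    and "q_Racah_type scale q a b c d A B C"
  defines "W \<equiv> pseudo_intertwiner scale q d a A"
    and "W' \<equiv> pseudo_intertwiner scale q d b B"
    and "W'' \<equiv> pseudo_intertwiner scale q d c C"
  shows "(W' \<circ> W) \<circ> (W'' \<circ> W') \<circ> (W \<circ> W'') =
           scale ((a * b * c) powi (- int d) * q ^ (d * (d - 1)))
         \<and> (W' \<circ> W) \<circ> (W'' \<circ> W') = (W'' \<circ> W') \<circ> (W' \<circ> W)
         \<and> (W'' \<circ> W') \<circ> (W \<circ> W'') = (W \<circ> W'') \<circ> (W'' \<circ> W')
         \<and> (W \<circ> W'') \<circ> (W' \<circ> W) = (W' \<circ> W) \<circ> (W \<circ> W'')"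
proof -
  note params = assms(3) and racah = assms(4)
  note params' = q_Racah_parameters_rotate[OF params] and racah' = q_Racah_type_rotate[OF racah]
  note params'' = q_Racah_parameters_rotate[OF params'] and racah'' = q_Racah_type_rotate[OF racah']
  obtain v where v: "racah_eigenbasis scale d v q a b c A B C"
    using q_Racah_type_eigenbasis[OF assms(1) params racah] by blast
  obtain v' where v': "racah_eigenbasis scale d v' q b c a B C A"
    using q_Racah_type_eigenbasis[OF assms(1) params' racah'] by blast
  obtain v'' where v'': "racah_eigenbasis scale d v'' q c a b C A B"
    using q_Racah_type_eigenbasis[OF assms(1) params'' racah''] by blast
  interpret R: racah_eigenbasis scale d v q a b c A B C by (rule v)
  interpret R': racah_eigenbasis scale d v' q b c a B C A by (rule v')
  interpret R'': racah_eigenbasis scale d v'' q c a b C A B by (rule v'')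
  note sum = R.W_sum R'.W_sum R''.W_sum R.sum_W R'.sum_W R''.sum_W
  note sum = sum[unfolded fun_eq_iff comp_apply, folded W_def W'_def W''_def, rule_format]
  note square = R.W_square_B R.W_square_C R'.W_square_B R'.W_square_C R''.W_square_B R''.W_square_C
  note square = square[unfolded fun_eq_iff comp_apply, folded W_def W'_def W''_def, rule_format]
  have endo [intro]: "R.endo W" "R.endo W'" "R.endo W''"
    by (simp_all add: W_def W'_def W''_def R.W_endo R'.W_endo R''.W_endo)

  have XS: "W' (W (A x + B x + C x)) = A (W' (W x)) + B (W' (W x)) + C (W' (W x))" for x
    using sum(1)[of x] sum(5)[of "W x"] by (simp add: add_ac)
  have YS: "W'' (W' (A x + B x + C x)) = A (W'' (W' x)) + B (W'' (W' x)) + C (W'' (W' x))" for x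
    using sum(2)[of x] sum(6)[of "W' x"] by (simp add: add_ac)
  have ZS: "W (W'' (A x + B x + C x)) = A (W (W'' x)) + B (W (W'' x)) + C (W (W'' x))" for x
    using sum(3)[of x] sum(4)[of "W'' x"] by (simp add: add_ac)
  have XY: "(W' \<circ> W) \<circ> (W'' \<circ> W') = (W'' \<circ> W') \<circ> (W' \<circ> W)"
    and YZ: "(W'' \<circ> W') \<circ> (W \<circ> W'') = (W \<circ> W'') \<circ> (W'' \<circ> W')"
    and ZX: "(W \<circ> W'') \<circ> (W' \<circ> W) = (W' \<circ> W) \<circ> (W \<circ> W'')"
    by (rule R.sum_commutant_commutative; (intro R.endo_comp endo)?; simp add: XS YS ZS)+

  \<comment> \<open>\<open>N\<close> commutes with \<open>A\<close>, and \<open>N W\<^sup>2\<close> also commutes with \<open>C\<close>, because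
    conjugation by \<open>W\<^sup>2\<close> turns \<open>C\<close> into \<open>C'\<close> and conjugation by \<open>W'\<^sup>2\<close> turns it back.\<close>
  define N where "N = W'' \<circ> W'' \<circ> W' \<circ> W'"
  have N: "R.endo N" unfolding N_def by (intro R.endo_comp endo)
  have NA: "N (A x) = A (N x)" for x
    unfolding N_def using square(4)[of x] square(5)[of "W' (W' x)"] by simp
  have L_C: "W' (W' (W (W (C x)))) = C (W' (W' (W (W x))))" for x
    using square(2)[of x] square(3)[of "W (W x)"] by simp
  have L_endo: "R.endo (W' \<circ> W' \<circ> W \<circ> W)" by (intro R.endo_comp endo)
  have WA: "W (A x) = A (W x)" for x
    using R.W_A by (simp add: fun_eq_iff W_def)
  have WC: "W'' (C x) = C (W'' x)" for x
    using R''.W_A by (simp add: fun_eq_iff W''_def)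
  obtain \<kappa> where \<kappa>: "N \<circ> W \<circ> W = scale \<kappa>"
  proof -
    have "\<exists>\<kappa>. N \<circ> W \<circ> W = scale \<kappa>"
    proof (rule R.commuting_with_pair_scalar)
      show "R.endo (N \<circ> W \<circ> W)" by (intro R.endo_comp N endo)
      show "(N \<circ> W \<circ> W) \<circ> A = A \<circ> (N \<circ> W \<circ> W)" by (simp add: fun_eq_iff WA NA)
      show "(N \<circ> W \<circ> W) \<circ> C = C \<circ> (N \<circ> W \<circ> W)" by (simp add: fun_eq_iff N_def WC L_C)
    qed (rule R.endo_C R.irreducible_C)+
    then show ?thesis using that by blast
  qed
  then have \<kappa>': "N (W (W x)) = scale \<kappa> x" for x by (simp add: fun_eq_iff)

  obtain h where h: "degree h \<le> d"
    "coeff h d = inverse (R'.u 0) ^ d / (\<Prod>i=1..d. 1 - q ^ (2 * i))"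
    "polynomial_map scale h B = W' \<circ> W'"
    using R'.W_square_polynomial unfolding W'_def by blast
  obtain g where g: "degree g \<le> d"
    "coeff g d = R''.u 0 ^ d / (\<Prod>i=1..d. 1 - inverse q ^ (2 * i))"
    "polynomial_map scale g C \<circ> (W'' \<circ> W'') = id"
    using R''.W_square_inverse_polynomial unfolding W''_def by blast
  have "W' (W' (W (W x))) = scale \<kappa> (polynomial_map scale g C x)" for x
  proof -
    have "W' (W' (W (W x))) = polynomial_map scale g C (N (W (W x)))"
      using g(3) by (simp add: N_def fun_eq_iff)
    then show ?thesis
      by (simp add: \<kappa>' R.endo_scale[OF R.polynomial_map_endo[OF R.endo_C]])
  qed
  then have corner: "R.w d * coeff h d = \<kappa> * coeff g d"
    by (intro R.corner_comparison h g) (simp add: h(3) flip: W_def)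
  have \<kappa>_value: "\<kappa> = (a * b * c) powi (- int d) * q ^ (d * (d - 1))"
  proof -
    have nz: "a \<noteq> 0" "b \<noteq> 0" "c \<noteq> 0" "q \<noteq> 0"
      using params by (auto simp: q_Racah_parameters_def)
    let ?P = "\<Prod>i=1..d. 1 - inverse q ^ (2 * i)" and ?P' = "\<Prod>i=1..d. 1 - q ^ (2 * i)"
    have P': "?P' = (- 1) ^ d * q ^ (d * (d + 1)) * ?P"
      by (rule prod_one_minus_inverse_power[OF nz(4), symmetric])
    have "?P' \<noteq> 0" using R.q_powers by auto
    then have P: "?P \<noteq> 0" unfolding P' by (simp only: mult_eq_0_iff not_False_eq_True simp_thms de_Morgan_disj)
    have u': "R'.u 0 = b / q ^ d" and u'': "R''.u 0 = c / q ^ d"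
      by (simp_all add: R'.u_def R''.u_def power_int_minus field_simps)
    have w: "R.w d = (- 1) ^ d / a ^ d"
      by (simp add: R.w_def power_int_minus field_simps)
    have "(- 1) ^ d / a ^ d * ((q ^ d / b) ^ d / ((- 1) ^ d * q ^ (d * (d + 1)) * ?P)) = \<kappa> * ((c / q ^ d) ^ d / ?P)"
      using corner unfolding h(2) g(2) u' u'' w P' by simp
    then have "\<kappa> * (a ^ d * b ^ d * c ^ d * q ^ (d * (d + 1))) = q ^ (d * d) * q ^ (d * d)"
      using nz P by (simp add: field_simps power_mult)
    also have "d * d + d * d = d * (d - 1) + d * (d + 1)"
      by (cases d) (simp_all add: algebra_simps)
    then have "q ^ (d * d) * q ^ (d * d) = q ^ (d * (d - 1)) * q ^ (d * (d + 1))"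
      by (simp only: power_add[symmetric])
    finally show ?thesis
      using nz by (simp add: power_int_minus power_mult_distrib field_simps)
  qed

  have "N \<circ> W = W \<circ> N"
    by (rule R.commutant_of_eigenbasis_commutative) (use N endo NA WA in \<open>auto simp: fun_eq_iff\<close>)
  then have NW: "N (W x) = W (N x)" for x by (simp add: fun_eq_iff)
  have "(W' \<circ> W) \<circ> (W'' \<circ> W') \<circ> (W \<circ> W'') = (W \<circ> W'') \<circ> ((W'' \<circ> W') \<circ> (W' \<circ> W))"
  proof -
    have "((W' \<circ> W) \<circ> (W'' \<circ> W')) \<circ> (W \<circ> W'') = (W'' \<circ> W') \<circ> ((W' \<circ> W) \<circ> (W \<circ> W''))"
      unfolding XY by (simp add: o_assoc)
    also have "\<dots> = ((W'' \<circ> W') \<circ> (W \<circ> W'')) \<circ> (W' \<circ> W)"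
      unfolding ZX[symmetric] by (simp add: o_assoc)
    also have "\<dots> = (W \<circ> W'') \<circ> ((W'' \<circ> W') \<circ> (W' \<circ> W))"
      unfolding YZ by (simp add: o_assoc)
    finally show ?thesis .
  qed
  also have "\<dots> = W \<circ> N \<circ> W" by (simp add: N_def o_assoc)
  also have "\<dots> = scale \<kappa>" using \<kappa>' by (simp add: fun_eq_iff flip: NW)
  finally show ?thesis using XY YZ ZX \<kappa>_value by simp
qed

end
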